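(* Let $k\ge1$ be an integer. There is a constant $C_2>0$ depending only on $k$ and $d$ such that the following holds. Let $m\ge0$ be an integer, let $P\subset\mathbb{R}^d$ be a dyadic cube and let $\alpha=\{\alpha_Q\}_{Q\in\mathscr{D}(P)}$ be a Carleson sequence. For every $k$-tuple of nonnegative integrable functions $f_1,\dots,f_k$ on $P$ there exists a sparse collection $\mathcal{S}$ of cubes in $\mathscr{D}(P)$ such that for all $x\in P$ $$\mathcal{A}^m_{P,\alpha}\vec f(x)\le C_2\,(m+1)\,\|\alpha\|_{\mathrm{Car}(P)}\sum_{Q\in\mathcal{S}}\Bigl(\prod_{i=1}^k\langle f_i\rangle_Q\Bigr)\mathbb{1}_Q(x).$$
   Context: For a cube $P\subset\mathbb{R}^d$, $\mathscr{D}(P)$ is the dyadic lattice obtained by successive dyadic subdivisions of $P$, $\mathscr{D}_j(P)$ is its $j$-th generation ($\mathscr{D}_0(P)=\{P\}$), and $\mathscr{D}_{\ge m}(P)=\bigcup_{j\ge m}\mathscr{D}_j(P)$. $Q^{(m)}$ is the $m$-th dyadic parent of $Q$ and $\langle f\rangle_Q=\frac1{|Q|}\int_Qf$. For a sequence $\alpha=\{\alpha_Q\}_{Q\in\mathscr{D}(P)}$ of nonnegative numbers, $$\|\alpha\|_{\mathrm{Car}(P)}=\sup_{R\in\mathscr{D}(P)}\frac1{|R|}\sum_{Q\in\mathscr{D}(R)}\alpha_Q|Q|,$$ and $\alpha$ is Carleson if $\|\alpha\|_{\mathrm{Car}(P)}<\infty$. The $k$-linear positive dyadic shift of complexity $m$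 is, with $\vec f=(f_1,\dots,f_k)$, $$\mathcal{A}^m_{P,\alpha}\vec f(x)=\sum_{Q\in\mathscr{D}_{\ge m}(P)}\alpha_Q\Bigl(\prod_{i=1}^k\langle f_i\rangle_{Q^{(m)}}\Bigr)\mathbb{1}_Q(x).$$ A collection $\mathcal{S}\subset\mathscr{D}(P)$ is sparse if for every $Q\in\mathcal{S}$ there is a measurable $E(Q)\subset Q$ with $|E(Q)|\ge\frac12|Q|$ and $E(Q)\cap E(Q')=\emptyset$ for distinct $Q,Q'\in\mathcal{S}$. *)

theory Defs
  imports "HOL-Analysis.Analysis"
begin

text \<open>
  Cubes are half-open with positive side length, so that every generation of a dyadic lattice
  is a genuine partition and pointwise statements hold at every point of the cube.
\<close>

definition cube :: "real^'n \<Rightarrow> real \<Rightarrow> (real^'n) set" where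
  "cube a l = {x. \<forall>i. a $ i \<le> x $ i \<and> x $ i < a $ i + l}"

definition is_cube :: "(real^'n) set \<Rightarrow> bool" where
  "is_cube P \<longleftrightarrow> (\<exists>a l. 0 < l \<and> P = cube a l)"

text \<open>The \<open>2\<^sup>d\<close> dyadic children: \<open>S\<close> is the set of coordinates in which the upper half is taken.\<close>

definition dyadic_children :: "(real^'n) set \<Rightarrow> (real^'n) set set" where
  "dyadic_children Q =
    {R. \<exists>a l S. 0 < l \<and> Q = cube a l \<and> R = cube (\<chi> i. if i \<in> S then a $ i + l / 2 else a $ i) (l / 2)}"

primrec dyadic_gen :: "nat \<Rightarrow> (real^'n) set \<Rightarrow> (real^'n) set set" where
  "dyadic_gen 0 P = {P}"
| "dyadic_gen (Suc j) P = (\<Union>Q\<in>dyadic_gen j P. dyadic_children Q)"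

definition dyadic_ge :: "nat \<Rightarrow> (real^'n) set \<Rightarrow> (real^'n) set set" where
  "dyadic_ge m P = (\<Union>j\<in>{m..}. dyadic_gen j P)"

definition dyadic :: "(real^'n) set \<Rightarrow> (real^'n) set set" where
  "dyadic P = (\<Union>j. dyadic_gen j P)"

definition dyadic_parent :: "(real^'n) set \<Rightarrow> nat \<Rightarrow> (real^'n) set \<Rightarrow> (real^'n) set" where
  "dyadic_parent P m Q = (THE R. R \<in> dyadic P \<and> Q \<in> dyadic_gen m R)"

definition average :: "(real^'n \<Rightarrow> real) \<Rightarrow> (real^'n) set \<Rightarrow> real" where
  "average f Q = (LINT x:Q|lebesgue. f x) / measure lebesgue Q"

text \<open>
  Sums over infinite families of cubes have nonnegative terms and may diverge, so they are taken
  in \<^typ>\<open>ennreal\<close>, where every such family is summable.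
\<close>

definition carleson_norm :: "(real^'n) set \<Rightarrow> ((real^'n) set \<Rightarrow> real) \<Rightarrow> ennreal" where
  "carleson_norm P \<alpha> =
    (SUP R\<in>dyadic P. ennreal (1 / measure lebesgue R) *
       (\<Sum>\<^sub>\<infinity>Q\<in>dyadic R. ennreal (\<alpha> Q * measure lebesgue Q)))"

definition carleson_seq :: "(real^'n) set \<Rightarrow> ((real^'n) set \<Rightarrow> real) \<Rightarrow> bool" where
  "carleson_seq P \<alpha> \<longleftrightarrow> (\<forall>Q\<in>dyadic P. 0 \<le> \<alpha> Q) \<and> carleson_norm P \<alpha> < \<infinity>"

definition positive_dyadic_shift ::
  "nat \<Rightarrow> nat \<Rightarrow> (real^'n) set \<Rightarrow> ((real^'n) set \<Rightarrow> real) \<Rightarrow> (nat \<Rightarrow> real^'n \<Rightarrow> real) \<Rightarrow> real^'n \<Rightarrow> ennreal"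
  where
  "positive_dyadic_shift k m P \<alpha> f x =
    (\<Sum>\<^sub>\<infinity>Q\<in>dyadic_ge m P.
       ennreal (\<alpha> Q * (\<Prod>i=1..k. average (f i) (dyadic_parent P m Q))) * indicator Q x)"

definition sparse_family :: "(real^'n) set \<Rightarrow> (real^'n) set set \<Rightarrow> bool" where
  "sparse_family P \<S> \<longleftrightarrow> \<S> \<subseteq> dyadic P \<and>
    (\<exists>E. (\<forall>Q\<in>\<S>. E Q \<in> sets lebesgue \<and> E Q \<subseteq> Q \<and> measure lebesgue (E Q) \<ge> 1 / 2 * measure lebesgue Q) \<and>
         disjoint_family_on E \<S>)"

text \<open>The definite description in \<^const>\<open>dyadic_parent\<close> is well defined on \<open>dyadic_ge m P\<close>.\<close>

lemma corner_in_cube: "0 < l \<Longrightarrow> a \<in> cube a l"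
  by (simp add: cube_def)

lemma cube_eq_imp:
  fixes a b :: "real^'n"
  assumes "cube a l = cube b r" "0 < l" "0 < r"
  shows "a = b \<and> l = r"
proof -
  have 1: "a = b"
  proof -
    have "a \<in> cube b r" "b \<in> cube a l"
      using corner_in_cube[OF assms(2), of a] corner_in_cube[OF assms(3), of b] assms(1) by auto
    then show ?thesis by (simp add: cube_def vec_eq_iff order_antisym)
  qed
  have sub: "s \<le> t" if "cube a s \<subseteq> cube a t" "0 < s" "0 < t" for s t
  proof (rule ccontr)
    assume "\<not> s \<le> t"
    then have "(\<chi> i. a $ i + t) \<in> cube a s" using that by (auto simp: cube_def)
    then have "(\<chi> i. a $ i + t) \<in> cube a t" using that(1) by blast
    then show False by (simp add: cube_def)
  qed
  show ?thesis using 1 sub[of l r] sub[of r l] assms by auto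
qed

lemma dyadic_children_cube:
  assumes "0 < l"
  shows "dyadic_children (cube a l) =
    range (\<lambda>S. cube (\<chi> i. if i \<in> S then a $ i + l / 2 else a $ i) (l / 2))"
  using assms cube_eq_imp unfolding dyadic_children_def by blast

lemma dyadic_children_disjoint:
  fixes a :: "real^'n"
  assumes "0 < l" "R \<in> dyadic_children (cube a l)" "R' \<in> dyadic_children (cube a l)" "x \<in> R" "x \<in> R'"
  shows "R = R'"
proof -
  obtain S S' where S: "R = cube (\<chi> i. if i \<in> S then a $ i + l / 2 else a $ i) (l / 2)"
    "R' = cube (\<chi> i. if i \<in> S' then a $ i + l / 2 else a $ i) (l / 2)"
    using assms by (auto simp: dyadic_children_cube)
  have "i \<in> S \<longleftrightarrow> i \<in> S'" for i
    using assms(4,5) S unfolding cube_def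
    by (auto dest!: spec[of _ i] split: if_splits)
  then have "S = S'" by blast
  then show ?thesis using S by simp
qed

lemma dyadic_children_subset:
  assumes "R \<in> dyadic_children Q"
  shows "R \<subseteq> Q"
proof
  fix x assume x: "x \<in> R"
  obtain a l S where "0 < l" "Q = cube a l" "R = cube (\<chi> i. if i \<in> S then a $ i + l / 2 else a $ i) (l / 2)"
    using assms unfolding dyadic_children_def by blast
  show "x \<in> Q"
    unfolding \<open>Q = _\<close> cube_def
  proof (intro CollectI allI)
    fix i
    show "a $ i \<le> x $ i \<and> x $ i < a $ i + l"
      using x \<open>0 < l\<close> unfolding \<open>R = _\<close> cube_def
      by (auto dest!: spec[of _ i] split: if_splits)
  qed
qed

lemma dyadic_gen_side:
  assumes "Q \<in> dyadic_gen j (cube a l)" "0 < l"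
  shows "\<exists>b. Q = cube b (l / 2 ^ j)"
  using assms(1)
proof (induction j arbitrary: Q)
  case (Suc j)
  then obtain R where R: "R \<in> dyadic_gen j (cube a l)" "Q \<in> dyadic_children R" by auto
  with Suc.IH obtain b where "R = cube b (l / 2 ^ j)" by blast
  with R assms(2) show ?case by (auto simp: dyadic_children_cube mult.commute)
qed auto

lemma dyadic_gen_subset: "Q \<in> dyadic_gen j P \<Longrightarrow> Q \<subseteq> P"
  by (induction j arbitrary: Q) (auto dest!: dyadic_children_subset)

lemma dyadic_gen_disjoint:
  assumes "0 < l" "Q \<in> dyadic_gen j (cube a l)" "Q' \<in> dyadic_gen j (cube a l)" "x \<in> Q" "x \<in> Q'"
  shows "Q = Q'"
  using assms(2-)
proof (induction j arbitrary: Q Q')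
  case (Suc j)
  then obtain R R' where R: "R \<in> dyadic_gen j (cube a l)" "Q \<in> dyadic_children R"
    "R' \<in> dyadic_gen j (cube a l)" "Q' \<in> dyadic_children R'" by auto
  then have "R = R'" using Suc dyadic_children_subset by blast
  moreover obtain b where "R = cube b (l / 2 ^ j)" using dyadic_gen_side R assms(1) by blast
  moreover have "0 < l / 2 ^ j" using assms(1) by simp
  ultimately show ?case using dyadic_children_disjoint[of "l / 2 ^ j"] R Suc.prems by blast
qed auto

lemma dyadic_gen_add: "Q \<in> dyadic_gen (j + m) P \<longleftrightarrow> (\<exists>R\<in>dyadic_gen j P. Q \<in> dyadic_gen m R)"
proof (induction m arbitrary: Q)
  case (Suc m)
  then show ?case by (simp del: UN_iff) blast
qed simp

lemma dyadic_parent_eq: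
  assumes "is_cube P" "R \<in> dyadic P" "Q \<in> dyadic_gen m R"
  shows "dyadic_parent P m Q = R"
  unfolding dyadic_parent_def
proof (rule the_equality)
  show "R \<in> dyadic P \<and> Q \<in> dyadic_gen m R" using assms by simp
next
  fix R' assume R': "R' \<in> dyadic P \<and> Q \<in> dyadic_gen m R'"
  obtain a l where P: "P = cube a l" "0 < l" using assms(1) is_cube_def by blast
  obtain j j' where j: "R \<in> dyadic_gen j P" "R' \<in> dyadic_gen j' P"
    using assms R' unfolding dyadic_def by blast
  then have "Q \<in> dyadic_gen (j + m) P" "Q \<in> dyadic_gen (j' + m) P"
    using assms R' dyadic_gen_add by blast+
  then obtain b b' where b: "Q = cube b (l / 2 ^ (j + m))" "Q = cube b' (l / 2 ^ (j' + m))"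
    using dyadic_gen_side P by blast
  then have "l / 2 ^ (j + m) = l / 2 ^ (j' + m)"
    using cube_eq_imp[of b "l / 2 ^ (j + m)" b' "l / 2 ^ (j' + m)"] P by simp
  then have "(2::real) ^ (j + m) = 2 ^ (j' + m)" using P by (simp add: field_simps)
  then have "j = j'" by simp
  moreover have "b \<in> Q" unfolding b(1) using P by (intro corner_in_cube) simp
  then have "b \<in> R" "b \<in> R'" using dyadic_gen_subset assms R' by blast+
  ultimately show "R' = R" using dyadic_gen_disjoint P j by blast
qed

lemma dyadic_parent_exists:
  assumes "Q \<in> dyadic_ge m P"
  shows "\<exists>R\<in>dyadic P. Q \<in> dyadic_gen m R"
proof -
  obtain j where "m \<le> j" "Q \<in> dyadic_gen j P" using assms unfolding dyadic_ge_def by auto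
  then have "Q \<in> dyadic_gen ((j - m) + m) P" by simp
  then show ?thesis unfolding dyadic_gen_add dyadic_def by blast
qed

end

theory Submission
  imports Defs
begin

text \<open>
  Let \<open>N\<close> be the Carleson norm. Starting from \<open>P\<close>, below a stopping cube \<open>S\<close> select the maximal
  cubes \<open>Q\<close> for which some average \<open>\<langle>f\<^sub>i\<rangle>\<^sub>Q\<close> exceeds \<open>4k \<langle>f\<^sub>i\<rangle>\<^sub>S\<close> or the sum of \<open>\<alpha>\<close> over the
  cubes between \<open>Q\<close> and \<open>S\<close> exceeds \<open>4N\<close>. By the weak-type bound for the dyadic maximal function
  and by Markov's inequality they cover at most \<open>k \<cdot> 1/(4k) + 1/4 = 1/2\<close> of \<open>S\<close>, so the stopping
  cubes are sparse. At a point \<open>x\<close>, the terms of the shift whose parent \<open>Q\<^sup>(\<^sup>m\<^sup>)\<close> is governed by \<open>S\<close>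
  have averages at most \<open>(4k)\<^sup>k\<close> times those on \<open>S\<close>, while their coefficients add up to at most
  \<open>4N + mN\<close>: only the last \<open>m\<close> of them may lie beyond the stopping time, and each is at most \<open>N\<close>.
\<close>

section \<open>Dyadic cubes through a point\<close>

lemma cube_sets_lebesgue [measurable]: "cube (a::real^'n) l \<in> sets lebesgue"
proof -
  have "cube a l = (\<Inter>i. {x. a $ i \<le> x $ i} \<inter> {x. x $ i < a $ i + l})"
    by (auto simp: cube_def)
  also have "\<dots> \<in> sets borel"
    by (intro sets.finite_INT sets.Int borel_closed borel_open closed_Collect_le open_Collect_less
        continuous_intros) auto
  finally show ?thesis by auto
qed

lemma is_cube_lmeasurable:
  fixes Q :: "(real^'n) set"
  assumes "is_cube Q"
  shows "Q \<in> lmeasurable" "0 < measure lebesgue Q"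
proof -
  obtain a l where Q: "Q = cube a l" "0 < l" using assms is_cube_def by blast
  have "Q \<subseteq> cbox a (a + (\<chi> i. l))"
    using Q by (auto simp: cube_def mem_box_cart less_imp_le)
  then have "bounded Q" using bounded_cbox bounded_subset by blast
  then show Q1: "Q \<in> lmeasurable"
    unfolding Q by (intro bounded_set_imp_lmeasurable) auto
  have box: "box a (a + (\<chi> i. l)) \<subseteq> Q"
    using Q by (auto simp: cube_def mem_box_cart less_imp_le)
  have "a + (\<chi> i. l / 2) \<in> box a (a + (\<chi> i. l))"
    using Q by (simp add: mem_box_cart)
  then have "\<not> negligible (box a (a + (\<chi> i. l)))"
    by (intro open_not_negligible) auto
  then have "\<not> negligible Q" using box negligible_subset by blast
  then have "measure lebesgue Q \<noteq> 0" using Q1 by (simp add: negligible_iff_measure)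
  then show "0 < measure lebesgue Q" by (simp add: less_le)
qed

lemma emeasure_is_cube:
  assumes "is_cube Q"
  shows "emeasure lebesgue Q = ennreal (measure lebesgue Q)"
  using is_cube_lmeasurable[OF assms] by (simp add: emeasure_eq_measure2)

lemma is_cube_dyadic_gen:
  assumes "is_cube P" "Q \<in> dyadic_gen j P"
  shows "is_cube Q"
proof -
  obtain a l where P: "P = cube a l" "0 < l" using assms(1) is_cube_def by blast
  then obtain b where "Q = cube b (l / 2 ^ j)" using dyadic_gen_side assms(2) by blast
  moreover have "0 < l / 2 ^ j" using P by simp
  ultimately show ?thesis unfolding is_cube_def by blast
qed

lemma is_cube_dyadic: "is_cube P \<Longrightarrow> Q \<in> dyadic P \<Longrightarrow> is_cube Q"
  using is_cube_dyadic_gen by (auto simp: dyadic_def)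

lemma is_cube_nonempty: "is_cube P \<Longrightarrow> P \<noteq> {}"
  using corner_in_cube by (auto simp: is_cube_def)

lemma finite_dyadic_children:
  assumes "is_cube (Q::(real^'n) set)"
  shows "finite (dyadic_children Q)"
proof -
  obtain a l where "Q = cube a l" "0 < l" using assms(1) is_cube_def by blast
  then show ?thesis by (simp add: dyadic_children_cube)
qed

lemma finite_dyadic_gen: "is_cube P \<Longrightarrow> finite (dyadic_gen j P)"
  by (induction j) (auto intro!: finite_dyadic_children dest: is_cube_dyadic_gen)

lemma countable_dyadic: "is_cube P \<Longrightarrow> countable (dyadic P)"
  unfolding dyadic_def by (simp add: countable_finite finite_dyadic_gen)

lemma dyadic_gen_unique_level:
  assumes "is_cube P" "Q \<in> dyadic_gen i P" "Q \<in> dyadic_gen j P"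
  shows "i = j"
proof -
  obtain a l where P: "P = cube a l" "0 < l" using assms(1) is_cube_def by blast
  obtain b c where "Q = cube b (l / 2 ^ i)" "Q = cube c (l / 2 ^ j)"
    using dyadic_gen_side assms P by metis
  then have "l / 2 ^ i = l / 2 ^ j"
    using cube_eq_imp[of b "l / 2 ^ i" c "l / 2 ^ j"] P by simp
  then have "(2::real) ^ i = 2 ^ j" using P by (simp add: field_simps)
  then show ?thesis by simp
qed

lemma dyadic_children_cover:
  assumes "is_cube (Q::(real^'n) set)" "x \<in> Q"
  shows "\<exists>R\<in>dyadic_children Q. x \<in> R"
proof -
  obtain a l where Q: "Q = cube a l" "0 < l" using assms(1) is_cube_def by blast
  define S where "S = {i. a $ i + l / 2 \<le> x $ i}"
  have "x \<in> cube (\<chi> i. if i \<in> S then a $ i + l / 2 else a $ i) (l / 2)"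
    unfolding cube_def
  proof (intro CollectI allI)
    fix i
    have "a $ i \<le> x $ i \<and> x $ i < a $ i + l" using assms(2) Q by (auto simp: cube_def)
    then show "(\<chi> i. if i \<in> S then a $ i + l / 2 else a $ i) $ i \<le> x $ i \<and>
        x $ i < (\<chi> i. if i \<in> S then a $ i + l / 2 else a $ i) $ i + l / 2"
      by (simp add: S_def)
  qed
  then show ?thesis using Q by (auto simp: dyadic_children_cube)
qed

lemma dyadic_gen_cover:
  assumes "is_cube P" "x \<in> P"
  shows "\<exists>Q\<in>dyadic_gen j P. x \<in> Q"
proof (induction j)
  case 0
  then show ?case using assms by simp
next
  case (Suc j)
  then obtain Q where Q: "Q \<in> dyadic_gen j P" "x \<in> Q" by blast
  then obtain R where "R \<in> dyadic_children Q" "x \<in> R"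
    using dyadic_children_cover is_cube_dyadic_gen assms(1) by blast
  with Q show ?case by auto
qed

text \<open>The cubes containing \<open>x\<close> form a tower with exactly one cube per generation.
  Indexing the tower by \<open>nat\<close> turns pointwise sums over cubes into sums over
  generations. The description is meaningful for a cube \<open>P\<close> and
  \<open>x \<in> P\<close>, by covering and disjointness.\<close>

definition dyadic_at :: "(real^'n) set \<Rightarrow> real^'n \<Rightarrow> nat \<Rightarrow> (real^'n) set" where
  "dyadic_at P x j = (THE Q. Q \<in> dyadic_gen j P \<and> x \<in> Q)"

lemma dyadic_at_eq:
  assumes "is_cube P" "Q \<in> dyadic_gen j P" "x \<in> Q"
  shows "dyadic_at P x j = Q"
proof -
  obtain a l where "P = cube a l" "0 < l" using assms(1) is_cube_def by blast
  then show ?thesis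
    unfolding dyadic_at_def using assms dyadic_gen_disjoint by (intro the_equality) blast+
qed

lemma dyadic_at_gen:
  assumes "is_cube P" "x \<in> P"
  shows "dyadic_at P x j \<in> dyadic_gen j P" "x \<in> dyadic_at P x j"
  using dyadic_gen_cover[OF assms, of j] dyadic_at_eq[OF assms(1)] by auto

lemma dyadic_at_dyadic:
  assumes "is_cube P" "x \<in> P"
  shows "dyadic_at P x j \<in> dyadic P"
  using dyadic_at_gen(1)[OF assms] by (auto simp: dyadic_def)

lemma is_cube_dyadic_at:
  assumes "is_cube P" "x \<in> P"
  shows "is_cube (dyadic_at P x j)"
  using dyadic_at_gen[OF assms] is_cube_dyadic_gen assms by blast

lemma dyadic_at_add:
  assumes "is_cube P" "x \<in> P"
  shows "dyadic_at P x (j + i) = dyadic_at (dyadic_at P x j) x i"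
proof -
  let ?R = "dyadic_at P x j"
  have "dyadic_at ?R x i \<in> dyadic_gen i ?R" "x \<in> dyadic_at ?R x i"
    using dyadic_at_gen[OF is_cube_dyadic_at[OF assms]] dyadic_at_gen[OF assms] by auto
  then show ?thesis
    using dyadic_at_gen(1)[OF assms] by (intro dyadic_at_eq assms) (auto simp: dyadic_gen_add)
qed

lemma dyadic_at_antimono:
  assumes "is_cube P" "x \<in> P" "i \<le> j"
  shows "dyadic_at P x j \<subseteq> dyadic_at P x i"
proof -
  have "dyadic_at P x j = dyadic_at (dyadic_at P x i) x (j - i)"
    using dyadic_at_add[OF assms(1,2), of i "j - i"] assms(3) by simp
  then show ?thesis
    using dyadic_at_gen(1)[OF is_cube_dyadic_at[OF assms(1,2)]] dyadic_at_gen(2)[OF assms(1,2)]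
      dyadic_gen_subset by metis
qed

text \<open>The source of every later locality argument: whatever depends only on the first
  generations of the tower, up to \<open>j\<close>, is constant on each cube of generation
  \<open>j\<close>.\<close>

lemma dyadic_at_local:
  assumes "is_cube P" "x \<in> P" "y \<in> dyadic_at P x j" "i \<le> j"
  shows "dyadic_at P y i = dyadic_at P x i"
  using dyadic_at_gen(1)[OF assms(1,2)] dyadic_at_antimono[OF assms(1,2,4)] assms
  by (intro dyadic_at_eq) auto

lemma inj_dyadic_at:
  assumes "is_cube P" "x \<in> P"
  shows "inj (dyadic_at P x)"
  using dyadic_at_gen(1)[OF assms] dyadic_gen_unique_level[OF assms(1)]
  by (metis injI)

lemma dyadic_parent_at:
  assumes "is_cube P" "x \<in> P"
  shows "dyadic_parent P m (dyadic_at P x (j + m)) = dyadic_at P x j"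
  using dyadic_at_gen[OF assms] dyadic_at_gen(1)[OF is_cube_dyadic_at[OF assms]]
  by (intro dyadic_parent_eq assms dyadic_at_dyadic) (simp add: dyadic_at_add[OF assms])

text \<open>Only members of the tower over \<open>x\<close> contribute, and no cube occurs in it
  twice, so the sum can be reindexed by generation.\<close>

lemma infsum_dyadic_indicator:
  fixes g :: "(real^'n) set \<Rightarrow> ennreal"
  assumes "is_cube P" "x \<in> P" "\<S> \<subseteq> dyadic P"
  shows "(\<Sum>\<^sub>\<infinity>Q\<in>\<S>. g Q * indicator Q x) = (\<Sum>\<^sub>\<infinity>j\<in>{j. dyadic_at P x j \<in> \<S>}. g (dyadic_at P x j))"
proof -
  have "(\<Sum>\<^sub>\<infinity>Q\<in>\<S>. g Q * indicator Q x) = (\<Sum>\<^sub>\<infinity>Q\<in>dyadic_at P x ` {j. dyadic_at P x j \<in> \<S>}. g Q)"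
  proof (rule infsum_cong_neutral)
    fix Q assume Q: "Q \<in> \<S> - dyadic_at P x ` {j. dyadic_at P x j \<in> \<S>}"
    have "x \<notin> Q"
    proof
      assume "x \<in> Q"
      moreover obtain j where "Q \<in> dyadic_gen j P" using Q assms(3) by (auto simp: dyadic_def)
      ultimately have "dyadic_at P x j = Q" using dyadic_at_eq assms(1) by blast
      then show False using Q by blast
    qed
    then show "g Q * indicator Q x = 0" by simp
  next
    fix Q assume "Q \<in> \<S> \<inter> dyadic_at P x ` {j. dyadic_at P x j \<in> \<S>}"
    then show "g Q * indicator Q x = g Q" using dyadic_at_gen(2)[OF assms(1,2)] by auto
  qed auto
  also have "\<dots> = (\<Sum>\<^sub>\<infinity>j\<in>{j. dyadic_at P x j \<in> \<S>}. g (dyadic_at P x j))"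
    by (subst infsum_reindex) (auto intro: inj_on_subset[OF inj_dyadic_at[OF assms(1,2)]] simp: o_def)
  finally show ?thesis .
qed

section \<open>Two weak-type estimates\<close>

text \<open>Presents the superlevel set of a dyadic maximal function as a union of selected cubes,
  the form in which its measure can be estimated.\<close>

lemma dyadic_at_union:
  assumes "is_cube P"
  shows "{y\<in>P. \<exists>i. B (dyadic_at P y i)} = \<Union>{Q\<in>dyadic P. B Q}"
proof (intro set_eqI iffI)
  fix y assume "y \<in> {y\<in>P. \<exists>i. B (dyadic_at P y i)}"
  then obtain i where "y \<in> P" "B (dyadic_at P y i)" by blast
  then show "y \<in> \<Union>{Q\<in>dyadic P. B Q}"
    using dyadic_at_dyadic[OF assms] dyadic_at_gen(2)[OF assms] by blast
next
  fix y assume "y \<in> \<Union>{Q\<in>dyadic P. B Q}"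
  then obtain Q j where "Q \<in> dyadic_gen j P" "B Q" "y \<in> Q" by (auto simp: dyadic_def)
  then show "y \<in> {y\<in>P. \<exists>i. B (dyadic_at P y i)}"
    using dyadic_at_eq[OF assms] dyadic_gen_subset by blast
qed

lemma dyadic_Union_sets:
  assumes "is_cube P" "\<Q> \<subseteq> dyadic P"
  shows "\<Union>\<Q> \<in> sets lebesgue"
proof (rule sets.countable_Union)
  show "countable \<Q>" using countable_dyadic[OF assms(1)] assms(2) countable_subset by blast
  show "\<Q> \<subseteq> sets lebesgue"
    using is_cube_lmeasurable(1) is_cube_dyadic assms by blast
qed

text \<open>Among the dyadic cubes selected by \<open>B\<close>, the maximal ones are disjoint and have the same union.\<close>

lemma emeasure_dyadic_union_le:
  assumes P: "is_cube P" and M: "sets M = sets lebesgue" and N: "sets N = sets lebesgue"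
    and le: "\<And>Q. Q \<in> dyadic P \<Longrightarrow> B Q \<Longrightarrow> emeasure M Q \<le> emeasure N Q"
  shows "emeasure M (\<Union>{Q\<in>dyadic P. B Q}) \<le> emeasure N (\<Union>{Q\<in>dyadic P. B Q})"
proof -
  define I where "I = {Q\<in>dyadic P. B Q \<and> (\<forall>R\<in>dyadic P. B R \<longrightarrow> Q \<subseteq> R \<longrightarrow> R = Q)}"
  have first: "\<exists>i. dyadic_at P y i \<in> I \<and> (\<forall>Q\<in>I. y \<in> Q \<longrightarrow> Q = dyadic_at P y i)"
    if "R \<in> dyadic P" "B R" "y \<in> R" for y R
  proof -
    have y: "y \<in> P" using that dyadic_gen_subset by (auto simp: dyadic_def)
    have at: "\<exists>i. Q = dyadic_at P y i" if "Q \<in> dyadic P" "y \<in> Q" for Q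
      using dyadic_at_eq[OF P] that by (auto simp: dyadic_def)
    \<comment> \<open>Towers decrease, so the first selected generation over \<open>y\<close> gives
      a cube containing every other selected cube through \<open>y\<close>. This supplies the
      maximal cube and its uniqueness at once.\<close>
    define i where "i = (LEAST i. B (dyadic_at P y i))"
    have Bi: "B (dyadic_at P y i)"
      unfolding i_def using at that by (metis LeastI)
    have min: "i \<le> j" if "B (dyadic_at P y j)" for j
      unfolding i_def using that by (rule Least_le)
    have sub: "Q \<subseteq> dyadic_at P y i" if "Q \<in> dyadic P" "B Q" "y \<in> Q" for Q
      using at[OF that(1,3)] min that dyadic_at_antimono[OF P y] by blast
    have "dyadic_at P y i \<in> I"
      unfolding I_def using Bi dyadic_at_dyadic[OF P y] dyadic_at_gen(2)[OF P y] sub by blast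
    moreover have "Q = dyadic_at P y i" if "Q \<in> I" "y \<in> Q" for Q
    proof -
      have "Q \<in> dyadic P" "B Q" using that(1) by (auto simp: I_def)
      from sub[OF this that(2)] show ?thesis
        using that(1) Bi dyadic_at_dyadic[OF P y] unfolding I_def by blast
    qed
    ultimately show ?thesis by blast
  qed
  have U: "\<Union>{Q\<in>dyadic P. B Q} = (\<Union>Q\<in>I. Q)"
  proof (intro equalityI subsetI)
    fix y assume "y \<in> \<Union>{Q\<in>dyadic P. B Q}"
    then obtain R where "R \<in> dyadic P" "B R" "y \<in> R" by blast
    from first[OF this] obtain i where "dyadic_at P y i \<in> I" by blast
    moreover have "y \<in> P" using \<open>R \<in> dyadic P\<close> \<open>y \<in> R\<close> dyadic_gen_subset by (auto simp: dyadic_def)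
    then have "y \<in> dyadic_at P y i" using dyadic_at_gen(2)[OF P] by simp
    ultimately show "y \<in> (\<Union>Q\<in>I. Q)" by (rule UN_I)
  next
    fix y assume "y \<in> (\<Union>Q\<in>I. Q)"
    then show "y \<in> \<Union>{Q\<in>dyadic P. B Q}" by (auto simp: I_def)
  qed
  have disj: "disjoint_family_on (\<lambda>Q. Q) I"
    unfolding disjoint_family_on_def
  proof (intro ballI impI equals0I)
    fix Q R y assume *: "Q \<in> I" "R \<in> I" "Q \<noteq> R" "y \<in> Q \<inter> R"
    then have "Q \<in> dyadic P" "B Q" "y \<in> Q" by (auto simp: I_def)
    from first[OF this] show False using * by blast
  qed
  have I: "countable I" "\<And>Q. Q \<in> I \<Longrightarrow> Q \<in> sets lebesgue"
    using countable_dyadic[OF P] is_cube_lmeasurable(1) is_cube_dyadic[OF P]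
    by (auto simp: I_def intro: countable_subset)
  \<comment> \<open>Both measures are countably additive over the disjoint family \<open>I\<close>,
    so the inequality on single cubes adds up.\<close>
  show ?thesis
    unfolding U
    using I M N disj le
    by (subst (1 2) emeasure_UN_countable) (auto intro!: nn_integral_mono simp: I_def)
qed

text \<open>Integration of \<open>f\<close> over subsets of \<open>P\<close> is treated as a second
  measure. A lower bound on averages then becomes a comparison of measures on cubes, as
  \<open>emeasure_dyadic_union_le\<close> requires.\<close>

lemma average_integral:
  assumes P: "is_cube P" and f: "set_integrable lebesgue P f" "\<And>x. x \<in> P \<Longrightarrow> 0 \<le> f x"
    and Q: "Q \<in> dyadic P"
  shows "ennreal (average f Q) * emeasure lebesgue Q =
    emeasure (density lebesgue (\<lambda>x. ennreal (f x * indicator P x))) Q"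
    and "0 \<le> average f Q"
proof -
  have c: "is_cube Q" using is_cube_dyadic P Q by blast
  have Qm: "Q \<in> sets lebesgue" using is_cube_lmeasurable(1)[OF c] by blast
  have sub: "Q \<subseteq> P" using Q dyadic_gen_subset by (auto simp: dyadic_def)
  have fQ: "set_integrable lebesgue Q f" using set_integrable_subset[OF f(1) Qm sub] .
  have nn: "0 \<le> f x * indicator Q x" for x using f(2) sub by (auto simp: indicator_def)
  have int: "integrable lebesgue (\<lambda>x. f x * indicator P x)"
    using f(1) by (simp add: set_integrable_def mult.commute)
  have i: "(LINT x:Q|lebesgue. f x) = (LINT x|lebesgue. f x * indicator Q x)"
    by (simp add: set_lebesgue_integral_def mult.commute)
  show "0 \<le> average f Q" unfolding average_def i
    using nn by (intro divide_nonneg_nonneg integral_nonneg) auto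
  have "emeasure (density lebesgue (\<lambda>x. ennreal (f x * indicator P x))) Q =
     (\<integral>\<^sup>+x. ennreal (f x * indicator P x) * indicator Q x \<partial>lebesgue)"
    using int Qm by (intro emeasure_density) auto
  also have "\<dots> = (\<integral>\<^sup>+x. ennreal (f x * indicator Q x) \<partial>lebesgue)"
    using sub by (intro nn_integral_cong) (auto simp: indicator_def)
  also have "\<dots> = ennreal (LINT x:Q|lebesgue. f x)"
    unfolding i using nn fQ
    by (intro nn_integral_eq_integral) (auto simp: set_integrable_def mult.commute)
  also have "\<dots> = ennreal (average f Q) * emeasure lebesgue Q"
    using is_cube_lmeasurable(2)[OF c] \<open>0 \<le> average f Q\<close>
    by (subst emeasure_is_cube[OF c]) (simp add: average_def flip: ennreal_mult)
  finally show "ennreal (average f Q) * emeasure lebesgue Q =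
    emeasure (density lebesgue (\<lambda>x. ennreal (f x * indicator P x))) Q" by simp
qed

lemma dyadic_self: "P \<in> dyadic P"
  by (auto simp: dyadic_def intro!: exI[of _ 0])

text \<open>The weak-type (1,1) bound with constant 1. Adding c \<langle>f\<rangle>_P |Q| \<le>
  \<integral>_Q f over the maximal selected cubes bounds the left side by \<integral>_P f =
  \<langle>f\<rangle>_P |P|, and \<langle>f\<rangle>_P is then cancelled.\<close>

lemma weak_type_average:
  assumes P: "is_cube P" and f: "set_integrable lebesgue P f" "\<And>x. x \<in> P \<Longrightarrow> 0 \<le> f x"
    and c: "0 < c"
  shows "emeasure lebesgue {y\<in>P. \<exists>i. average f (dyadic_at P y i) > c * average f P}
    \<le> ennreal (1 / c) * emeasure lebesgue P"
proof -
  let ?N = "density lebesgue (\<lambda>x. ennreal (f x * indicator P x))"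
  let ?U = "\<Union>{Q\<in>dyadic P. average f Q > c * average f P}"
  have U: "{y\<in>P. \<exists>i. average f (dyadic_at P y i) > c * average f P} = ?U"
    by (rule dyadic_at_union[OF P])
  have Um: "?U \<in> sets lebesgue" by (rule dyadic_Union_sets[OF P]) auto
  have UP: "?U \<subseteq> P" unfolding U[symmetric] by blast
  have Pm: "P \<in> sets lebesgue" using is_cube_lmeasurable(1)[OF P] by blast
  have avg: "ennreal (average f Q) * emeasure lebesgue Q = emeasure ?N Q" "0 \<le> average f Q"
    if "Q \<in> dyadic P" for Q
    using average_integral[OF P f(1) _ that] f(2) by auto
  have le: "ennreal t * emeasure lebesgue ?U \<le> emeasure ?N P"
    if t: "\<And>Q. Q \<in> dyadic P \<Longrightarrow> average f Q > c * average f P \<Longrightarrow> t \<le> average f Q" for t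
  proof -
    have "ennreal t * emeasure lebesgue ?U = emeasure (scale_measure (ennreal t) lebesgue) ?U"
      by simp
    also have "\<dots> \<le> emeasure ?N ?U"
      using t by (intro emeasure_dyadic_union_le[OF P])
        (auto simp: avg(1)[symmetric] intro!: mult_right_mono ennreal_leI)
    also have "\<dots> \<le> emeasure ?N P" using UP Pm by (intro emeasure_mono) auto
    finally show ?thesis .
  qed
  note [simp] = avg(1)[OF dyadic_self, symmetric]
  show ?thesis
  proof (cases "average f P = 0")
    \<comment> \<open>Cancellation is impossible here. However, the integral of \<open>f\<close>
      then vanishes on every dyadic subcube, so nothing is selected.\<close>
    case True
    have "?U = {}"
    proof (rule ccontr)
      assume "?U \<noteq> {}"
      then obtain Q where Q: "Q \<in> dyadic P" "average f Q > 0" using True by auto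
      have "Q \<subseteq> P" using Q dyadic_gen_subset by (auto simp: dyadic_def)
      then have "emeasure ?N Q \<le> emeasure ?N P" using Pm by (intro emeasure_mono) auto
      then have "ennreal (average f Q) * emeasure lebesgue Q = 0"
        using avg(1)[OF Q(1)] True by simp
      then show False
        using Q is_cube_lmeasurable(2)[OF is_cube_dyadic[OF P Q(1)]]
        by (simp add: emeasure_is_cube[OF is_cube_dyadic[OF P Q(1)]])
    qed
    then show ?thesis unfolding U by (simp only: emeasure_empty zero_le)
  next
    case False
    then have pos: "0 < average f P" using avg(2)[OF dyadic_self] by simp
    have "emeasure lebesgue ?U
      = ennreal (1 / (c * average f P)) * (ennreal (c * average f P) * emeasure lebesgue ?U)"
      using pos c by (simp add: mult.assoc[symmetric] ennreal_mult[symmetric])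
    also have "\<dots> \<le> ennreal (1 / (c * average f P)) * (ennreal (average f P) * emeasure lebesgue P)"
      using le[of "c * average f P"] by (intro mult_left_mono) auto
    also have "\<dots> = ennreal (1 / c) * emeasure lebesgue P"
      using pos c by (simp add: mult.assoc[symmetric] ennreal_mult[symmetric])
    finally show ?thesis unfolding U .
  qed
qed

text \<open>At a fixed generation the coefficient is a simple function of the point, which gives its
  measurability and its integral.\<close>

lemma sum_dyadic_at:
  assumes "is_cube P"
  shows "ennreal (\<alpha> (dyadic_at P y i)) * indicator P y
    = (\<Sum>Q\<in>dyadic_gen i P. ennreal (\<alpha> Q) * indicator Q y)"
proof (cases "y \<in> P")
  case True
  have "(\<Sum>Q\<in>dyadic_gen i P. ennreal (\<alpha> Q) * indicator Q y)
    = (\<Sum>Q\<in>{dyadic_at P y i}. ennreal (\<alpha> Q) * indicator Q y)"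
    using dyadic_at_gen[OF assms True] dyadic_at_eq[OF assms] finite_dyadic_gen[OF assms]
    by (intro sum.mono_neutral_right) (auto simp: indicator_def)
  then show ?thesis using True dyadic_at_gen[OF assms True] by simp
next
  case False
  then have "y \<notin> Q" if "Q \<in> dyadic_gen i P" for Q using that dyadic_gen_subset by blast
  then show ?thesis using False by simp
qed

text \<open>Markov's inequality for \<open>h\<close>, the total coefficient along the tower: its
  integral is the packing sum, at most \<open>N\<close> times the measure of \<open>P\<close>, and
  \<open>h\<close> exceeds \<open>c * N\<close> on the set in question.\<close>

lemma weak_type_sum:
  assumes P: "is_cube P" and \<alpha>: "\<And>Q. Q \<in> dyadic P \<Longrightarrow> 0 \<le> \<alpha> Q" and N: "0 \<le> N"
    and car: "(\<Sum>\<^sub>\<infinity>Q\<in>dyadic P. ennreal (\<alpha> Q * measure lebesgue Q)) \<le> ennreal N * emeasure lebesgue P"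
    and c: "0 < c"
  shows "emeasure lebesgue {y\<in>P. \<exists>n. c * N < (\<Sum>i\<le>n. \<alpha> (dyadic_at P y i))}
    \<le> ennreal (1 / c) * emeasure lebesgue P"
proof -
  define h where "h y = (\<Sum>i. ennreal (\<alpha> (dyadic_at P y i)) * indicator P y)" for y
  let ?U = "{y\<in>P. \<exists>n. c * N < (\<Sum>i\<le>n. \<alpha> (dyadic_at P y i))}"
  have gen_m: "Q \<in> sets lebesgue" if "Q \<in> dyadic_gen i P" for Q i
    using is_cube_lmeasurable(1)[OF is_cube_dyadic_gen[OF P that]] by blast
  have meas: "(\<lambda>y. ennreal (\<alpha> (dyadic_at P y i)) * indicator P y) \<in> borel_measurable lebesgue" for i
    unfolding sum_dyadic_at[OF P] using gen_m
    by (intro borel_measurable_sum borel_measurable_times_ennreal borel_measurable_indicator) auto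
  have h_meas: "h \<in> borel_measurable lebesgue" unfolding h_def using meas by measurable
  have "(\<integral>\<^sup>+y. h y \<partial>lebesgue)
      = (\<Sum>i. \<integral>\<^sup>+y. ennreal (\<alpha> (dyadic_at P y i)) * indicator P y \<partial>lebesgue)"
    unfolding h_def by (intro nn_integral_suminf meas)
  also have "\<dots> = (\<Sum>i. \<Sum>Q\<in>dyadic_gen i P. ennreal (\<alpha> Q * measure lebesgue Q))"
  proof (intro suminf_cong)
    fix i
    have "(\<integral>\<^sup>+y. ennreal (\<alpha> (dyadic_at P y i)) * indicator P y \<partial>lebesgue)
      = (\<Sum>Q\<in>dyadic_gen i P. \<integral>\<^sup>+y. ennreal (\<alpha> Q) * indicator Q y \<partial>lebesgue)"
      unfolding sum_dyadic_at[OF P] using gen_m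
      by (intro nn_integral_sum borel_measurable_times_ennreal borel_measurable_indicator) auto
    also have "\<dots> = (\<Sum>Q\<in>dyadic_gen i P. ennreal (\<alpha> Q * measure lebesgue Q))"
    proof (intro sum.cong refl)
      fix Q assume Q: "Q \<in> dyadic_gen i P"
      then have "Q \<in> dyadic P" by (auto simp: dyadic_def)
      then show "(\<integral>\<^sup>+y. ennreal (\<alpha> Q) * indicator Q y \<partial>lebesgue) = ennreal (\<alpha> Q * measure lebesgue Q)"
        using gen_m[OF Q] \<alpha> emeasure_is_cube[OF is_cube_dyadic_gen[OF P Q]]
        by (simp add: nn_integral_cmult_indicator ennreal_mult)
    qed
    finally show "(\<integral>\<^sup>+y. ennreal (\<alpha> (dyadic_at P y i)) * indicator P y \<partial>lebesgue)
      = (\<Sum>Q\<in>dyadic_gen i P. ennreal (\<alpha> Q * measure lebesgue Q))" .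
  qed
  \<comment> \<open>Distinct generations share no cube, so each partial sum over generations is a
    finite subsum of the packing sum.\<close>
  also have "\<dots> \<le> (\<Sum>\<^sub>\<infinity>Q\<in>dyadic P. ennreal (\<alpha> Q * measure lebesgue Q))"
  proof (rule suminf_le_const)
    fix n
    have "(\<Sum>i<n. \<Sum>Q\<in>dyadic_gen i P. ennreal (\<alpha> Q * measure lebesgue Q))
      = (\<Sum>Q\<in>(\<Union>i<n. dyadic_gen i P). ennreal (\<alpha> Q * measure lebesgue Q))"
      using finite_dyadic_gen[OF P] dyadic_gen_unique_level[OF P]
      by (subst sum.UNION_disjoint) auto
    also have "\<dots> \<le> (\<Sum>\<^sub>\<infinity>Q\<in>dyadic P. ennreal (\<alpha> Q * measure lebesgue Q))"
      using finite_dyadic_gen[OF P]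
      by (subst nonneg_infsum_complete) (auto simp: dyadic_def intro!: SUP_upper)
    finally show "(\<Sum>i<n. \<Sum>Q\<in>dyadic_gen i P. ennreal (\<alpha> Q * measure lebesgue Q))
      \<le> (\<Sum>\<^sub>\<infinity>Q\<in>dyadic P. ennreal (\<alpha> Q * measure lebesgue Q))" .
  qed auto
  also note car
  finally have int: "(\<integral>\<^sup>+y. h y \<partial>lebesgue) \<le> ennreal N * emeasure lebesgue P" .
  have big: "ennreal (c * N) < h y" if y: "y \<in> ?U" for y
  proof -
    obtain n where n: "y \<in> P" "c * N < (\<Sum>i\<le>n. \<alpha> (dyadic_at P y i))" using y by blast
    have "ennreal (c * N) < ennreal (\<Sum>i\<le>n. \<alpha> (dyadic_at P y i))"
      using n N c by (intro ennreal_lessI) (auto intro: le_less_trans[rotated])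
    also have "\<dots> = (\<Sum>i\<le>n. ennreal (\<alpha> (dyadic_at P y i)))"
      using \<alpha> dyadic_at_dyadic[OF P n(1)] by (intro sum_ennreal[symmetric]) auto
    also have "\<dots> \<le> h y"
      unfolding h_def using n(1) sum_le_suminf[of "\<lambda>i. ennreal (\<alpha> (dyadic_at P y i))" "{..n}"]
      by simp
    finally show ?thesis .
  qed
  show ?thesis
  proof (cases "N = 0")
    \<comment> \<open>The Markov threshold degenerates to zero. Instead, \<open>h\<close> has zero
      integral, hence vanishes almost everywhere, while it is positive on the set.\<close>
    case True
    have "emeasure lebesgue {y \<in> space lebesgue. h y \<noteq> 0} = 0"
      using int True h_meas by (simp add: nn_integral_0_iff)
    moreover have "emeasure lebesgue ?U \<le> emeasure lebesgue {y \<in> space lebesgue. h y \<noteq> 0}"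
    proof (intro emeasure_mono)
      show "?U \<subseteq> {y \<in> space lebesgue. h y \<noteq> 0}" using big True by fastforce
    qed (use h_meas in measurable)
    ultimately show ?thesis by simp
  next
    case False
    then have pos: "0 < c * N" using N c by simp
    let ?V = "{y \<in> space lebesgue. 1 \<le> ennreal (1 / (c * N)) * h y}"
    have "emeasure lebesgue ?U \<le> emeasure lebesgue ?V"
    proof (intro emeasure_mono)
      show "?U \<subseteq> ?V"
      proof
        fix y assume "y \<in> ?U"
        then have "ennreal (1 / (c * N)) * ennreal (c * N) \<le> ennreal (1 / (c * N)) * h y"
          using big by (intro mult_left_mono) (auto intro: less_imp_le)
        then show "y \<in> ?V" using pos False c by (auto simp: ennreal_mult[symmetric])
      qed
    qed (use h_meas in measurable)
    also have "\<dots> \<le> ennreal (1 / (c * N)) * (\<integral>\<^sup>+y. h y * indicator (space lebesgue) y \<partial>lebesgue)"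
      using h_meas by (intro nn_integral_Markov_inequality) auto
    also have "\<dots> \<le> ennreal (1 / (c * N)) * (ennreal N * emeasure lebesgue P)"
      using int by (intro mult_left_mono) auto
    also have "\<dots> = ennreal (1 / c) * emeasure lebesgue P"
      using pos N False c by (simp add: mult.assoc[symmetric] ennreal_mult[symmetric])
    finally show ?thesis .
  qed
qed

section \<open>The stopping index\<close>

text \<open>Here \<open>st s j\<close> means that generation \<open>j\<close> triggers a stop when
  the current stopping generation is \<open>s\<close>. The value at \<open>j\<close> is the last
  stopping generation up to \<open>j\<close>, so stopping generations are exactly the fixed points;
  generation 0 always is one.\<close>

primrec stop_index :: "(nat \<Rightarrow> nat \<Rightarrow> bool) \<Rightarrow> nat \<Rightarrow> nat" where
  "stop_index st 0 = 0"
| "stop_index st (Suc j) = (if st (stop_index st j) (Suc j) then Suc j else stop_index st j)"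

lemma stop_index_le: "stop_index st j \<le> j"
  by (induction j) auto

lemma stop_index_idem: "stop_index st (stop_index st j) = stop_index st j"
  by (induction j) auto

lemma stop_index_not: "stop_index st j = j \<or> \<not> st (stop_index st j) j"
  by (induction j) auto

text \<open>The recursion up to \<open>j\<close> consults \<open>st s i\<close> only for
  \<open>s \<le> i \<le> j\<close>. Hence a local stopping rule makes the stopping status of a cube
  independent of the point chosen in it.\<close>

lemma stop_index_cong:
  assumes "\<And>s i. s \<le> i \<Longrightarrow> i \<le> j \<Longrightarrow> st s i = st' s i"
  shows "stop_index st j = stop_index st' j"
  using assms by (induction j) (auto simp: stop_index_le le_SucI)

text \<open>The first change of the index away from \<open>s\<close> must be triggered by
  \<open>st s\<close>. In contrapositive form this says that a point with no trigger after
  \<open>s\<close> meets no later stopping cube.\<close>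

lemma stop_index_leaves:
  assumes "stop_index st s = s" "s \<le> i" "stop_index st i \<noteq> s"
  shows "\<exists>t>s. st s t"
  using assms(2,3)
proof (induction i rule: dec_induct)
  case base
  then show ?case using assms(1) by simp
next
  case (step i)
  show ?case
  proof (cases "stop_index st i = s")
    case True
    then have "st s (Suc i)" using step.prems by (auto split: if_splits)
    then show ?thesis using step.hyps by (intro exI[of _ "Suc i"]) simp
  next
    case False
    then show ?thesis using step.IH by blast
  qed
qed

text \<open>The \<open>m\<close> extra terms come from the shift: the part of the window \<open>s + m..t + m\<close> that
  lies beyond the stopping time has at most \<open>m\<close> terms.\<close>

lemma sum_shifted_window:
  fixes a :: "nat \<Rightarrow> real"
  assumes "s \<le> t" "\<And>i. 0 \<le> a i" "\<And>i. a i \<le> N" "(\<Sum>i=s..t. a i) \<le> 4 * N"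
  shows "(\<Sum>j=s..t. a (j + m)) \<le> 4 * (real m + 1) * N"
proof -
  have N: "0 \<le> N" using assms(2,3)[of 0] by linarith
  have "(\<Sum>j=s..t. a (j + m)) = (\<Sum>i=s+m..t+m. a i)"
    by (rule sum.shift_bounds_cl_nat_ivl[symmetric])
  also have "\<dots> \<le> (\<Sum>i\<in>{s..t} \<union> {t<..t+m}. a i)"
    using assms(2) by (intro sum_mono2) auto
  also have "\<dots> = (\<Sum>i=s..t. a i) + (\<Sum>i\<in>{t<..t+m}. a i)"
    by (intro sum.union_disjoint) auto
  also have "\<dots> \<le> 4 * N + real m * N"
    using assms(4) sum_bounded_above[of "{t<..t+m}" a N] assms(3) by (intro add_mono) auto
  also have "\<dots> \<le> 4 * (real m + 1) * N" using N by (simp add: algebra_simps)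
  finally show ?thesis .
qed

text \<open>The pointwise domination along one tower: \<open>a\<close> stands for the coefficients
  and \<open>b\<close> for the products of averages. Indices are grouped by their governing stopping
  generation; in each group \<open>b\<close> costs a factor \<open>K\<close> and the shifted
  coefficients are summed by \<open>sum_shifted_window\<close>.\<close>

lemma stopping_sum_le:
  fixes a b :: "nat \<Rightarrow> real"
  assumes a: "\<And>i. 0 \<le> a i" "\<And>i. a i \<le> N" and b: "\<And>i. 0 \<le> b i" and K: "1 \<le> K"
    and st: "\<And>s j. s < j \<Longrightarrow> \<not> st s j \<Longrightarrow> (\<Sum>i=s..j. a i) \<le> 4 * N \<and> b j \<le> K * b s"
  shows "(\<Sum>j<n. a (j + m) * b j)
    \<le> 4 * K * (real m + 1) * N * (\<Sum>s\<in>{s. s < n \<and> stop_index st s = s}. b s)"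
proof -
  let ?p = "stop_index st" and ?S = "{s. s < n \<and> stop_index st s = s}"
  have N: "0 \<le> N" using a[of 0] by linarith
  have bK: "b j \<le> K * b (?p j)" for j
  proof (cases "?p j = j")
    case True
    then show ?thesis using mult_right_mono[OF K b[of j]] by simp
  next
    case False
    then show ?thesis using st[of "?p j" j] stop_index_not[of st j] stop_index_le[of st j] by auto
  qed
  have "(\<Sum>j<n. a (j + m) * b j) \<le> (\<Sum>j<n. a (j + m) * (K * b (?p j)))"
    using bK a by (intro sum_mono mult_left_mono) auto
  also have "\<dots> = (\<Sum>s\<in>?S. \<Sum>j\<in>{j\<in>{..<n}. ?p j = s}. a (j + m) * (K * b (?p j)))"
    by (rule sum.group[symmetric])
      (auto simp: stop_index_idem intro: le_less_trans[OF stop_index_le])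
  also have "\<dots> = (\<Sum>s\<in>?S. (\<Sum>j\<in>{j\<in>{..<n}. ?p j = s}. a (j + m)) * (K * b s))"
    by (simp add: sum_distrib_right)
  also have "\<dots> \<le> (\<Sum>s\<in>?S. (4 * (real m + 1) * N) * (K * b s))"
  proof (intro sum_mono mult_right_mono)
    fix s assume s: "s \<in> ?S"
    define J where "J = {j\<in>{..<n}. ?p j = s}"
    \<comment> \<open>The last index below \<open>n\<close> governed by \<open>s\<close>. The whole
      group lies in \<open>{s..t}\<close>, and \<open>t\<close> either equals \<open>s\<close> or
      failed the test \<open>st s t\<close>, which bounds the sum of \<open>a\<close> over that
      range.\<close>
    define t where "t = Max J"
    have J: "finite J" "s \<in> J" using s by (auto simp: J_def)
    then have t: "t \<in> J" "s \<le> t" using Max_in[of J] Max_ge[of J s] unfolding t_def by blast+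
    have "J \<subseteq> {s..t}"
    proof
      fix j assume j: "j \<in> J"
      then have "s \<le> j" using stop_index_le[of st j] by (auto simp: J_def)
      then show "j \<in> {s..t}" using j J Max_ge[of J j] by (auto simp: t_def)
    qed
    then have "(\<Sum>j\<in>J. a (j + m)) \<le> (\<Sum>j=s..t. a (j + m))"
      using a by (intro sum_mono2) auto
    also have "\<dots> \<le> 4 * (real m + 1) * N"
    proof (rule sum_shifted_window)
      show "(\<Sum>i=s..t. a i) \<le> 4 * N"
      proof (cases "s = t")
        case True
        then show ?thesis using a(2)[of s] N by simp
      next
        case False
        then have "s < t" "\<not> st s t"
          using t stop_index_not[of st t] by (auto simp: J_def)
        then show ?thesis using st by blast
      qed
    qed (use t a in auto)
    finally show "(\<Sum>j\<in>J. a (j + m)) \<le> 4 * (real m + 1) * N" .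
  qed (use b K in auto)
  also have "\<dots> = 4 * K * (real m + 1) * N * (\<Sum>s\<in>?S. b s)"
    by (simp add: sum_distrib_left mult.assoc mult.left_commute)
  finally show ?thesis .
qed

section \<open>Sparseness of the stopping cubes\<close>

text \<open>If a condition witnessed at generation \<open>t\<close> persists on the whole cube of
  that generation, the set is a union of dyadic cubes, of which there are only countably
  many.\<close>

lemma dyadic_local_sets:
  assumes P: "is_cube P"
    and local: "\<And>x y t. x \<in> P \<Longrightarrow> y \<in> dyadic_at P x t \<Longrightarrow> C x t \<Longrightarrow> C y t"
  shows "{y\<in>P. \<exists>t. C y t} \<in> sets lebesgue"
proof -
  let ?\<Q> = "{Q. \<exists>x\<in>P. \<exists>t. C x t \<and> Q = dyadic_at P x t}"
  have sub: "?\<Q> \<subseteq> dyadic P" using dyadic_at_dyadic[OF P] by blast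
  have "{y\<in>P. \<exists>t. C y t} = \<Union>?\<Q>"
  proof (intro equalityI subsetI)
    fix y assume "y \<in> {y\<in>P. \<exists>t. C y t}"
    then show "y \<in> \<Union>?\<Q>" using dyadic_at_gen(2)[OF P] by blast
  next
    fix y assume "y \<in> \<Union>?\<Q>"
    then obtain x t where "x \<in> P" "C x t" "y \<in> dyadic_at P x t" by blast
    then show "y \<in> {y\<in>P. \<exists>t. C y t}"
      using local dyadic_gen_subset dyadic_at_gen(1)[OF P] by blast
  qed
  then show ?thesis using dyadic_Union_sets[OF P sub] by simp
qed

definition stopping_cubes ::
  "(real^'n) set \<Rightarrow> (real^'n \<Rightarrow> nat \<Rightarrow> nat \<Rightarrow> bool) \<Rightarrow> (real^'n) set set" where
  "stopping_cubes P st = {dyadic_at P x j | x j. x \<in> P \<and> stop_index (st x) j = j}"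

text \<open>Membership may be witnessed by another point \<open>y\<close> of the same cube.
  Generations are determined by cubes, and locality transfers the stopping index from
  \<open>y\<close> to \<open>x\<close>.\<close>

lemma dyadic_at_stopping_iff:
  assumes P: "is_cube P" and x: "x \<in> P"
    and local: "\<And>x y s i j. x \<in> P \<Longrightarrow> y \<in> dyadic_at P x j \<Longrightarrow> s \<le> i \<Longrightarrow> i \<le> j \<Longrightarrow> st y s i = st x s i"
  shows "dyadic_at P x j \<in> stopping_cubes P st \<longleftrightarrow> stop_index (st x) j = j"
proof
  assume "dyadic_at P x j \<in> stopping_cubes P st"
  then obtain y i where y: "y \<in> P" "dyadic_at P x j = dyadic_at P y i" "stop_index (st y) i = i"
    unfolding stopping_cubes_def by blast
  have "i = j"
    using dyadic_gen_unique_level[OF P] dyadic_at_gen(1)[OF P x, of j] dyadic_at_gen(1)[OF P y(1), of i] y(2)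
    by metis
  then have "x \<in> dyadic_at P y j" using dyadic_at_gen(2)[OF P x, of j] y(2) by simp
  then have "stop_index (st x) j = stop_index (st y) j"
    using local[OF y(1)] by (intro stop_index_cong) auto
  then show "stop_index (st x) j = j" using y \<open>i = j\<close> by simp
qed (use x in \<open>auto simp: stopping_cubes_def\<close>)

lemma stopping_cubes_sparse:
  assumes P: "is_cube P"
    and local: "\<And>x y s i j. x \<in> P \<Longrightarrow> y \<in> dyadic_at P x j \<Longrightarrow> s \<le> i \<Longrightarrow> i \<le> j \<Longrightarrow> st y s i = st x s i"
    and small: "\<And>x s. x \<in> P \<Longrightarrow>
      emeasure lebesgue {y \<in> dyadic_at P x s. \<exists>t>s. st y s t} \<le> ennreal (1 / 2) * emeasure lebesgue (dyadic_at P x s)"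
  shows "sparse_family P (stopping_cubes P st)"
proof -
  \<comment> \<open>\<open>E Q\<close> removes from \<open>Q\<close> the points where a later stop
    is triggered. The quantified \<open>s\<close> recovers the generation of \<open>Q\<close>, which
    is unique because the tower over \<open>y\<close> is injective.\<close>
  define E where "E Q = {y\<in>Q. \<forall>s t. Q = dyadic_at P y s \<longrightarrow> s < t \<longrightarrow> \<not> st y s t}" for Q
  have E: "E Q \<in> sets lebesgue \<and> E Q \<subseteq> Q \<and> measure lebesgue (E Q) \<ge> 1 / 2 * measure lebesgue Q"
    if stop: "Q \<in> stopping_cubes P st" for Q
  proof -
    obtain x s where x: "x \<in> P" "Q = dyadic_at P x s"
      using stop unfolding stopping_cubes_def by blast
    define W where "W = {y\<in>Q. \<exists>t>s. st y s t}"
    have Q: "is_cube Q" using is_cube_dyadic_at[OF P] x by simp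
    note Qm = is_cube_lmeasurable[OF Q]
    have QP: "Q \<subseteq> P" using dyadic_at_gen(1)[OF P x(1)] dyadic_gen_subset x(2) by blast
    have at: "dyadic_at P y i = Q \<longleftrightarrow> i = s" if "y \<in> Q" for y i
    proof -
      have "dyadic_at P y s = Q" using dyadic_at_local[OF P x(1), of y s s] that x(2) by simp
      then show ?thesis using injD[OF inj_dyadic_at[OF P, of y]] that QP by blast
    qed
    \<comment> \<open>Membership in \<open>Q\<close> joins the condition so that it is local on
      \<open>P\<close>: for \<open>t > s\<close>, a generation-\<open>t\<close> cube meeting
      \<open>Q\<close> lies inside \<open>Q\<close>.\<close>
    have W: "W = {y\<in>P. \<exists>t. y \<in> Q \<and> s < t \<and> st y s t}"
      using QP unfolding W_def by blast
    have Wm: "W \<in> sets lebesgue"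
      unfolding W
    proof (rule dyadic_local_sets[OF P])
      fix y z t assume y: "y \<in> P" "z \<in> dyadic_at P y t" "y \<in> Q \<and> s < t \<and> st y s t"
      have "z \<in> dyadic_at P y s" using dyadic_at_antimono[OF P y(1), of s t] y by auto
      moreover have "dyadic_at P y s = Q" using at y(3) by simp
      ultimately have "z \<in> Q" by simp
      then show "z \<in> Q \<and> s < t \<and> st z s t" using local[OF y(1,2), of s t] y by simp
    qed
    have EQ: "E Q = Q - W"
    proof (intro set_eqI)
      fix y
      have "(\<forall>r t. Q = dyadic_at P y r \<longrightarrow> r < t \<longrightarrow> \<not> st y r t) \<longleftrightarrow> (\<forall>t>s. \<not> st y s t)" if "y \<in> Q"
        using at[OF that] by metis
      then show "y \<in> E Q \<longleftrightarrow> y \<in> Q - W" unfolding E_def W_def by blast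
    qed
    have WQ: "W \<subseteq> Q" unfolding W_def by blast
    then have Wl: "W \<in> lmeasurable" using fmeasurableI2[OF Qm(1) _ Wm] by blast
    have "ennreal (measure lebesgue W) = emeasure lebesgue W"
      using Wl by (simp add: emeasure_eq_measure2)
    also have "\<dots> \<le> ennreal (1 / 2) * emeasure lebesgue Q"
      using small[OF x(1), of s] unfolding W_def x(2) .
    also have "\<dots> = ennreal (1 / 2 * measure lebesgue Q)"
      unfolding emeasure_is_cube[OF Q] by (rule ennreal_mult[symmetric]) auto
    finally have "measure lebesgue W \<le> 1 / 2 * measure lebesgue Q"
      by (subst (asm) ennreal_le_iff) auto
    moreover have "measure lebesgue (E Q) = measure lebesgue Q - measure lebesgue W"
      unfolding EQ using Qm(1) Wl WQ by (intro measurable_measure_Diff) auto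
    ultimately show ?thesis using EQ Wm Qm(1) by auto
  qed
  have "disjoint_family_on E (stopping_cubes P st)"
    unfolding disjoint_family_on_def
  proof (intro ballI impI equals0I)
    fix Q R y
    assume QR: "Q \<in> stopping_cubes P st" "R \<in> stopping_cubes P st" "Q \<noteq> R" and y: "y \<in> E Q \<inter> E R"
    have *: "\<exists>s. A = dyadic_at P y s \<and> stop_index (st y) s = s \<and> (\<forall>t>s. \<not> st y s t) \<and> y \<in> P"
      if A: "A \<in> stopping_cubes P st" "y \<in> E A" for A
    proof -
      obtain x s where x: "x \<in> P" "A = dyadic_at P x s"
        using A unfolding stopping_cubes_def by blast
      have yA: "y \<in> dyadic_at P x s" using A(2) x by (simp add: E_def)
      then have yP: "y \<in> P" using dyadic_at_gen(1)[OF P x(1)] dyadic_gen_subset by blast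
      have Ay: "A = dyadic_at P y s" using dyadic_at_local[OF P x(1) yA, of s] x by simp
      then have "stop_index (st y) s = s" using dyadic_at_stopping_iff[OF P yP local] A(1) by simp
      then show ?thesis using Ay A(2) yP unfolding E_def by blast
    qed
    obtain s where s: "Q = dyadic_at P y s" "stop_index (st y) s = s" "\<forall>t>s. \<not> st y s t"
      using *[OF QR(1)] y by blast
    obtain r where r: "R = dyadic_at P y r" "stop_index (st y) r = r" "\<forall>t>r. \<not> st y r t"
      using *[OF QR(2)] y by blast
    \<comment> \<open>Whichever of \<open>s\<close> and \<open>r\<close> is smaller, the other is a
      later stopping generation over \<open>y\<close>, so a trigger must occur after the smaller
      one, contrary to the choice of \<open>E\<close>.\<close>
    have "s \<noteq> r" using s r QR by blast
    then show False
      using stop_index_leaves[of "st y" s r] stop_index_leaves[of "st y" r s] s r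
      by (metis less_imp_le linorder_neqE_nat)
  qed
  moreover have "stopping_cubes P st \<subseteq> dyadic P"
    using dyadic_at_dyadic[OF P] by (auto simp: stopping_cubes_def)
  ultimately show ?thesis unfolding sparse_family_def using E by blast
qed

section \<open>Carleson sequences\<close>

lemma dyadic_trans: "Q \<in> dyadic P \<Longrightarrow> R \<in> dyadic Q \<Longrightarrow> R \<in> dyadic P"
  unfolding dyadic_def using dyadic_gen_add by blast

lemma carleson_norm_packing:
  assumes P: "is_cube P" and R: "R \<in> dyadic P"
  shows "(\<Sum>\<^sub>\<infinity>Q\<in>dyadic R. ennreal (\<alpha> Q * measure lebesgue Q)) \<le> carleson_norm P \<alpha> * emeasure lebesgue R"
proof -
  have c: "is_cube R" using is_cube_dyadic[OF P R] .
  have pos: "0 < measure lebesgue R" using is_cube_lmeasurable(2)[OF c] .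
  let ?s = "\<Sum>\<^sub>\<infinity>Q\<in>dyadic R. ennreal (\<alpha> Q * measure lebesgue Q)"
  have "?s = (ennreal (1 / measure lebesgue R) * ?s) * emeasure lebesgue R"
    using pos unfolding emeasure_is_cube[OF c]
    by (simp add: mult.commute[of _ ?s] mult.assoc ennreal_mult[symmetric])
  also have "\<dots> \<le> carleson_norm P \<alpha> * emeasure lebesgue R"
    unfolding carleson_norm_def using R by (intro mult_right_mono SUP_upper) auto
  finally show ?thesis .
qed

text \<open>The cube \<open>Q\<close> is itself one term of the packing sum over
  \<open>dyadic Q\<close>.\<close>

lemma carleson_norm_bound:
  assumes P: "is_cube P" and Q: "Q \<in> dyadic P" and N: "carleson_norm P \<alpha> = ennreal N" "0 \<le> N"
  shows "\<alpha> Q \<le> N"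
proof -
  have c: "is_cube Q" using is_cube_dyadic[OF P Q] .
  have pos: "0 < measure lebesgue Q" using is_cube_lmeasurable(2)[OF c] .
  have "ennreal (\<alpha> Q * measure lebesgue Q) = (\<Sum>\<^sub>\<infinity>R\<in>{Q}. ennreal (\<alpha> R * measure lebesgue R))" by simp
  also have "\<dots> \<le> (\<Sum>\<^sub>\<infinity>R\<in>dyadic Q. ennreal (\<alpha> R * measure lebesgue R))"
    by (intro infsum_mono_neutral) (auto simp: dyadic_self nonneg_summable_on_complete)
  also have "\<dots> \<le> ennreal N * emeasure lebesgue Q"
    using carleson_norm_packing[OF P Q, of \<alpha>] N by simp
  also have "\<dots> = ennreal (N * measure lebesgue Q)"
    unfolding emeasure_is_cube[OF c] using N by (simp add: ennreal_mult)
  finally show ?thesis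
    using N pos by (subst (asm) ennreal_le_iff) auto
qed

text \<open>The summation index \<open>j\<close> is the generation of the parent, so the coefficient
  sits at generation \<open>j + m\<close> and the averages at \<open>j\<close>.\<close>

lemma positive_dyadic_shift_at:
  assumes P: "is_cube P" and x: "x \<in> P"
  shows "positive_dyadic_shift k m P \<alpha> f x =
    (\<Sum>\<^sub>\<infinity>j. ennreal (\<alpha> (dyadic_at P x (j + m)) * (\<Prod>i=1..k. average (f i) (dyadic_at P x j))))"
proof -
  have sub: "dyadic_ge m P \<subseteq> dyadic P" by (auto simp: dyadic_ge_def dyadic_def)
  have "{j. dyadic_at P x j \<in> dyadic_ge m P} = {m..}"
    using dyadic_at_gen(1)[OF P x] dyadic_gen_unique_level[OF P] by (auto simp: dyadic_ge_def)
  also have "\<dots> = range (\<lambda>j. j + m)"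
    by (auto simp: image_iff intro: le_add_diff_inverse2[symmetric])
  finally have r: "{j. dyadic_at P x j \<in> dyadic_ge m P} = range (\<lambda>j. j + m)" .
  show ?thesis
    unfolding positive_dyadic_shift_def infsum_dyadic_indicator[OF P x sub] r
    by (subst infsum_reindex) (auto simp: o_def dyadic_parent_at[OF P x])
qed

section \<open>The stopping rule, its sparseness and the pointwise bound\<close>

theorem theorem2p5:
  fixes k :: nat
  assumes "k \<ge> 1"
  shows "\<exists>C2::real. C2 > 0 \<and>
    (\<forall>(m::nat) (P::(real^'n) set) (\<alpha>::(real^'n) set \<Rightarrow> real) (f::nat \<Rightarrow> real^'n \<Rightarrow> real).
      is_cube P \<longrightarrow> carleson_seq P \<alpha> \<longrightarrow>
      (\<forall>i\<in>{1..k}. set_integrable lebesgue P (f i) \<and> (\<forall>x\<in>P. 0 \<le> f i x)) \<longrightarrow>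
      (\<exists>\<S>. sparse_family P \<S> \<and>
        (\<forall>x\<in>P. positive_dyadic_shift k m P \<alpha> f x
           \<le> ennreal (C2 * (real m + 1)) * carleson_norm P \<alpha> *
               (\<Sum>\<^sub>\<infinity>Q\<in>\<S>. ennreal (\<Prod>i=1..k. average (f i) Q) * indicator Q x))))"
proof -
  \<comment> \<open>The factor \<open>4 * real k\<close> leaves each of the \<open>k\<close>
    functions an exceptional set of relative measure at most 1/(4k). Comparing products of
    \<open>k\<close> averages costs its \<open>k\<close>-th power, so the final constant
    \<open>4 * K\<close> depends on \<open>k\<close> alone.\<close>
  define c K where "c = 4 * real k" and "K = c ^ k"
  have c: "1 \<le> c" "0 < c" using assms by (auto simp: c_def)
  then have K: "1 \<le> K" by (simp add: K_def)
  show ?thesis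
  proof (intro exI[of _ "4 * K"] conjI allI impI)
    fix m :: nat and P :: "(real^'n) set" and \<alpha> :: "(real^'n) set \<Rightarrow> real" and f :: "nat \<Rightarrow> real^'n \<Rightarrow> real"
    assume P: "is_cube P" and car: "carleson_seq P \<alpha>"
      and f: "\<forall>i\<in>{1..k}. set_integrable lebesgue P (f i) \<and> (\<forall>x\<in>P. 0 \<le> f i x)"
    define N where "N = enn2real (carleson_norm P \<alpha>)"
    have N: "carleson_norm P \<alpha> = ennreal N" "0 \<le> N"
      using car by (auto simp: carleson_seq_def N_def)
    have \<alpha>: "0 \<le> \<alpha> Q" "\<alpha> Q \<le> N" if "Q \<in> dyadic P" for Q
      using car that carleson_norm_bound[OF P that N] by (auto simp: carleson_seq_def)
    define st where "st x s t \<longleftrightarrow>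
      (\<exists>i\<in>{1..k}. average (f i) (dyadic_at P x t) > c * average (f i) (dyadic_at P x s)) \<or>
      (\<Sum>i=s..t. \<alpha> (dyadic_at P x i)) > 4 * N" for x s t
    have local: "st y s i = st x s i"
      if "x \<in> P" "y \<in> dyadic_at P x j" "s \<le> i" "i \<le> j" for x y s i j
    proof -
      have "dyadic_at P y l = dyadic_at P x l" if "l \<le> i" for l
        using dyadic_at_local[OF P] \<open>i \<le> j\<close> \<open>x \<in> P\<close> \<open>y \<in> dyadic_at P x j\<close> that le_trans by blast
      then show ?thesis using \<open>s \<le> i\<close> by (simp add: st_def)
    qed
    have "sparse_family P (stopping_cubes P st)"
    proof (rule stopping_cubes_sparse[OF P local])
      fix x s assume x: "x \<in> P"
      define Q where "Q = dyadic_at P x s"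
      have Q: "Q \<in> dyadic P" "is_cube Q" "Q \<subseteq> P"
        using dyadic_at_dyadic[OF P x] is_cube_dyadic_at[OF P x] dyadic_at_gen(1)[OF P x] dyadic_gen_subset
        unfolding Q_def by blast+
      define B where "B i = {y\<in>Q. \<exists>l. average (f i) (dyadic_at Q y l) > c * average (f i) Q}" for i
      define A where "A = {y\<in>Q. \<exists>n. 4 * N < (\<Sum>i\<le>n. \<alpha> (dyadic_at Q y i))}"
      have Bm: "B i \<in> sets lebesgue" for i
        unfolding B_def
        using dyadic_at_local[OF Q(2)] by (intro dyadic_local_sets[OF Q(2)]) auto
      have Am: "A \<in> sets lebesgue"
        unfolding A_def
      proof (rule dyadic_local_sets[OF Q(2)])
        fix y z n assume "y \<in> Q" "z \<in> dyadic_at Q y n" "4 * N < (\<Sum>i\<le>n. \<alpha> (dyadic_at Q y i))"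
        then show "4 * N < (\<Sum>i\<le>n. \<alpha> (dyadic_at Q z i))"
          using dyadic_at_local[OF Q(2), of y z n] by simp
      qed
      \<comment> \<open>From generation \<open>s\<close> on, the tower in \<open>P\<close> is the
        tower in \<open>Q\<close>. A trigger after \<open>s\<close> therefore puts \<open>y\<close>
        in a superlevel set relative to \<open>Q\<close>, where the weak-type bounds apply.\<close>
      have "{y\<in>Q. \<exists>t>s. st y s t} \<subseteq> (\<Union>i\<in>{1..k}. B i) \<union> A"
      proof
        fix y assume "y \<in> {y\<in>Q. \<exists>t>s. st y s t}"
        then obtain t where y: "y \<in> Q" "s < t" "st y s t" by blast
        then have yP: "y \<in> P" using Q by blast
        have ys: "dyadic_at P y s = Q"
          using dyadic_at_local[OF P x, of y s s] y(1) by (simp add: Q_def)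
        have rel: "dyadic_at P y (s + l) = dyadic_at Q y l" for l
          using dyadic_at_add[OF P yP] ys by simp
        obtain l where t: "t = s + l" using y(2) less_imp_add_positive by blast
        have "(\<Sum>i=s..t. \<alpha> (dyadic_at P y i)) = (\<Sum>i\<le>l. \<alpha> (dyadic_at Q y i))"
          unfolding t rel[symmetric]
          using sum.shift_bounds_cl_nat_ivl[of "\<lambda>i. \<alpha> (dyadic_at P y i)" 0 s l]
          by (simp add: atMost_atLeast0 add.commute)
        then show "y \<in> (\<Union>i\<in>{1..k}. B i) \<union> A"
          using y(1,3) unfolding st_def ys A_def B_def t rel by auto
      qed
      then have "emeasure lebesgue {y\<in>Q. \<exists>t>s. st y s t} \<le> emeasure lebesgue ((\<Union>i\<in>{1..k}. B i) \<union> A)"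
        using Bm Am by (intro emeasure_mono) auto
      also have "\<dots> \<le> emeasure lebesgue (\<Union>i\<in>{1..k}. B i) + emeasure lebesgue A"
        using Bm Am by (intro emeasure_subadditive) auto
      also have "\<dots> \<le> (\<Sum>i=1..k. emeasure lebesgue (B i)) + emeasure lebesgue A"
        using Bm by (intro add_mono emeasure_subadditive_finite) auto
      also have "\<dots> \<le> (\<Sum>i=1..k. ennreal (1 / c) * emeasure lebesgue Q) + ennreal (1 / 4) * emeasure lebesgue Q"
      proof (intro add_mono sum_mono)
        fix i assume i: "i \<in> {1..k}"
        show "emeasure lebesgue (B i) \<le> ennreal (1 / c) * emeasure lebesgue Q"
          unfolding B_def
        proof (rule weak_type_average[OF Q(2)])
          show "set_integrable lebesgue Q (f i)"
            using f i is_cube_lmeasurable(1)[OF Q(2)] Q(3) set_integrable_subset by blast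
        qed (use f i Q(3) c in auto)
      next
        show "emeasure lebesgue A \<le> ennreal (1 / 4) * emeasure lebesgue Q"
          unfolding A_def
          using carleson_norm_packing[OF P Q(1), of \<alpha>] N \<alpha> dyadic_trans[OF Q(1)]
          by (intro weak_type_sum[OF Q(2)]) auto
      qed
      also have "\<dots> = ennreal (1 / 2) * emeasure lebesgue Q"
      proof -
        have "(\<Sum>i=1..k. ennreal (1 / c)) = ennreal (\<Sum>i=1..k. 1 / c)"
          using c by (intro sum_ennreal) auto
        also have "(\<Sum>i=1..k. 1 / c) = 1 / 4" using assms by (simp add: c_def)
        finally have "(\<Sum>i=1..k. ennreal (1 / c)) + ennreal (1 / 4) = ennreal (1 / 4 + 1 / 4)"
          by (simp add: ennreal_plus[symmetric] del: ennreal_plus)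
        also have "1 / 4 + 1 / 4 = (1 / 2 :: real)" by simp
        finally show ?thesis by (simp only: sum_distrib_right[symmetric] distrib_right[symmetric])
      qed
      finally show "emeasure lebesgue {y \<in> dyadic_at P x s. \<exists>t>s. st y s t}
          \<le> ennreal (1 / 2) * emeasure lebesgue (dyadic_at P x s)"
        unfolding Q_def .
    qed
    moreover have "positive_dyadic_shift k m P \<alpha> f x
        \<le> ennreal (4 * K * (real m + 1)) * carleson_norm P \<alpha> *
          (\<Sum>\<^sub>\<infinity>Q\<in>stopping_cubes P st. ennreal (\<Prod>i=1..k. average (f i) Q) * indicator Q x)"
      if x: "x \<in> P" for x
    proof -
      define a b where "a j = \<alpha> (dyadic_at P x j)"
        and "b j = (\<Prod>i=1..k. average (f i) (dyadic_at P x j))" for j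
      let ?C = "4 * K * (real m + 1) * N" and ?S = "{s. stop_index (st x) s = s}"
      have avg: "0 \<le> average (f i) (dyadic_at P x j)" if "i \<in> {1..k}" for i j
        using average_integral(2)[OF P _ _ dyadic_at_dyadic[OF P x]] f that by auto
      have a: "0 \<le> a j" "a j \<le> N" for j
        using \<alpha> dyadic_at_dyadic[OF P x] by (auto simp: a_def)
      have b: "0 \<le> b j" for j unfolding b_def using avg by (intro prod_nonneg) auto
      have C: "0 \<le> ?C" using K N by simp
      have step: "(\<Sum>i=s..j. a i) \<le> 4 * N \<and> b j \<le> K * b s" if "\<not> st x s j" for s j
      proof -
        have "b j \<le> (\<Prod>i=1..k. c * average (f i) (dyadic_at P x s))"
          unfolding b_def using that avg by (intro prod_mono) (auto simp: st_def not_less)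
        also have "\<dots> = K * b s" by (simp add: prod.distrib K_def b_def)
        finally show ?thesis using that by (auto simp: st_def a_def not_less)
      qed
      \<comment> \<open>Both sides may be infinite, so finite subsums are compared: each is enlarged
        to an initial segment \<open>{..<n}\<close>, where the real-valued estimate holds.\<close>
      have "(\<Sum>\<^sub>\<infinity>j. ennreal (a (j + m) * b j)) \<le> ennreal ?C * (\<Sum>\<^sub>\<infinity>s\<in>?S. ennreal (b s))"
      proof (rule infsum_le_finite_sums)
        fix F :: "nat set" assume "finite F"
        then obtain n where "F \<subseteq> {..<n}" using finite_nat_bounded by blast
        then have "(\<Sum>j\<in>F. ennreal (a (j + m) * b j)) \<le> (\<Sum>j<n. ennreal (a (j + m) * b j))"
          by (intro sum_mono2) auto
        also have "\<dots> = ennreal (\<Sum>j<n. a (j + m) * b j)"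
          using a b by (intro sum_ennreal) auto
        also have "\<dots> \<le> ennreal (?C * (\<Sum>s\<in>{s. s < n \<and> stop_index (st x) s = s}. b s))"
          using a b K step by (intro ennreal_leI stopping_sum_le) auto
        also have "\<dots> = ennreal ?C * (\<Sum>s\<in>{s. s < n \<and> stop_index (st x) s = s}. ennreal (b s))"
          using C b by (simp add: ennreal_mult sum_nonneg)
        also have "\<dots> \<le> ennreal ?C * (\<Sum>\<^sub>\<infinity>s\<in>?S. ennreal (b s))"
          by (intro mult_left_mono, subst nonneg_infsum_complete) (auto intro!: SUP_upper)
        finally show "(\<Sum>j\<in>F. ennreal (a (j + m) * b j)) \<le> ennreal ?C * (\<Sum>\<^sub>\<infinity>s\<in>?S. ennreal (b s))" .
      qed (simp add: nonneg_summable_on_complete)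
      \<comment> \<open>By locality the stopping cubes containing \<open>x\<close> correspond
        exactly to the fixed points of the stopping index over \<open>x\<close>.\<close>
      moreover have "(\<Sum>\<^sub>\<infinity>Q\<in>stopping_cubes P st. ennreal (\<Prod>i=1..k. average (f i) Q) * indicator Q x)
          = (\<Sum>\<^sub>\<infinity>s\<in>?S. ennreal (b s))"
        using dyadic_at_dyadic[OF P] dyadic_at_stopping_iff[OF P x local]
        by (subst infsum_dyadic_indicator[OF P x]) (auto simp: stopping_cubes_def b_def)
      moreover have "ennreal ?C = ennreal (4 * K * (real m + 1)) * carleson_norm P \<alpha>"
        unfolding N(1) using K N by (intro ennreal_mult) auto
      ultimately show ?thesis
        unfolding positive_dyadic_shift_at[OF P x] a_def b_def by simp
    qed
    ultimately show "\<exists>\<S>. sparse_family P \<S> \<and>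
        (\<forall>x\<in>P. positive_dyadic_shift k m P \<alpha> f x
           \<le> ennreal (4 * K * (real m + 1)) * carleson_norm P \<alpha> *
               (\<Sum>\<^sub>\<infinity>Q\<in>\<S>. ennreal (\<Prod>i=1..k. average (f i) Q) * indicator Q x))"
      by blast
  qed (use K in simp)
qed

end
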